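(* Let $\alpha$ be an arbitrary (possibly signed or complex) measure on $(\mathbb{R},\mathcal{B})$ with finite moments $\int x^n\,\mathrm{d}\alpha(x)$ for $0\le n\le N+d+1$, where $N\ge 1$ and $d\ge 0$ are integers. Let $0<\epsilon<1$ and let $$p(x)=x^{d+1}+\sum_{n=0}^{d}p_n x^n$$ be a monic polynomial (with complex coefficients) of degree $d+1$ that is $\epsilon$-quasiorthogonal of order $N$ with respect to $\alpha$ and the monomial basis, and whose zeros $x_0,\dots,x_d\in\mathbb{C}$ are pairwise distinct. Let $$w_n=\int \ell_n(x)\,\mathrm{d}\alpha(x),\qquad n=0,\dots,d,$$ where $\ell_n(x)=\prod_{m\neq n,\,0\le m\le d}\frac{x-x_m}{x_n-x_m}$ is the $n$-th Lagrange basis polynomial associated with the nodes $x_0,\dots,x_d$. Then for every polynomial $q(x)=\sum_{n=0}^{N+d}q_n x^n$ of degree at most $N+d$, $$\left|\int q(x)\,\mathrm{d}\alpha(x)-\sum_{n=0}^{d}w_n\,q(x_n)\right|\le \lVert \Gamma^{-1}\bar q\rVert_1\,\epsilon,$$ where $\bar q=(q_{d+1},q_{d+2},\dots,q_{N+d})^T$ and $\Gamma$ is the $N\times N$ upper triangular Toeplitz matrix with $[\Gamma]_{i,j}=p_{d+1-(j-i)}$ if $0\le j-i\le d+1$ and $[\Gamma]_{i,j}=0$ otherwise, with the convention $p_{d+1}=1$ (so the diagonal entries of $\Gamma$ are all $1$).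
   Context: $\mathcal{B}$ is the Borel $\sigma$-algebra. A polynomial $p$ is called $\epsilon$-quasiorthogonal of order $N$ with respect to a measure $\alpha$ and the monomial basis if $\left|\int p(x)\,x^n\,\mathrm{d}\alpha(x)\right|\le\epsilon$ for all $n=0,\dots,N$. A measure has a finite $n$-th moment if $x^n$ is (absolutely) integrable with respect to it. $\lVert v\rVert_1=\sum_i|v_i|$. *)

theory Defs
  imports
    "HOL-Analysis.Analysis"
    "HOL-Computational_Algebra.Polynomial"
    "Jordan_Normal_Form.Gauss_Jordan_Elimination"
    "Jordan_Normal_Form.Determinant"
begin

section \<open>Signed and complex measures\<close>

text \<open>
  A countably additive set function on the sets of \<open>M\<close>; only the \<open>\<sigma>\<close>-algebra of \<open>M\<close> matters.
  For values in \<open>real\<close> this is a finite signed measure, for values in \<open>complex\<close> a complex measure.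
  Extended-real-valued measures of infinite total variation are not covered; those have no finite
  zeroth moment.
\<close>

definition vector_measure :: "'a measure \<Rightarrow> ('a set \<Rightarrow> 'b::real_normed_vector) \<Rightarrow> bool" where
  "vector_measure M \<mu> \<longleftrightarrow> \<mu> {} = 0 \<and>
     (\<forall>A::nat \<Rightarrow> 'a set. range A \<subseteq> sets M \<longrightarrow> disjoint_family A \<longrightarrow>
        (\<lambda>i. \<mu> (A i)) sums \<mu> (\<Union>i. A i))"

abbreviation complex_measure :: "'a measure \<Rightarrow> ('a set \<Rightarrow> complex) \<Rightarrow> bool" where
  "complex_measure \<equiv> vector_measure"

text \<open>
  The positive part of the Jordan decomposition of \<open>\<nu>\<close>: \<open>\<nu>\<^sup>+(E) = sup {\<nu>(B) | B \<subseteq> E}\<close>.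
  Negative values are truncated by \<open>ennreal\<close>, which is harmless because \<open>B = {}\<close> is admitted.
  The negative part is the positive part of \<open>- \<nu>\<close>.
\<close>

definition upper_variation :: "'a measure \<Rightarrow> ('a set \<Rightarrow> real) \<Rightarrow> 'a set \<Rightarrow> ennreal" where
  "upper_variation M \<nu> E = (SUP B\<in>{B \<in> sets M. B \<subseteq> E}. ennreal (\<nu> B))"

definition pos_part :: "'a measure \<Rightarrow> ('a set \<Rightarrow> real) \<Rightarrow> 'a measure" where
  "pos_part M \<nu> = measure_of (space M) (sets M) (upper_variation M \<nu>)"

definition neg_part :: "'a measure \<Rightarrow> ('a set \<Rightarrow> real) \<Rightarrow> 'a measure" where
  "neg_part M \<nu> = pos_part M (\<lambda>A. - \<nu> A)"

text \<open>
  Integrability with respect to all four Jordan parts, i.e. absolute integrability with respect to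
  the total variation of \<open>\<mu>\<close>.
\<close>

definition cm_integrable :: "'a measure \<Rightarrow> ('a set \<Rightarrow> complex) \<Rightarrow> ('a \<Rightarrow> complex) \<Rightarrow> bool" where
  "cm_integrable M \<mu> f \<longleftrightarrow>
     integrable (pos_part M (\<lambda>A. Re (\<mu> A))) f \<and> integrable (neg_part M (\<lambda>A. Re (\<mu> A))) f \<and>
     integrable (pos_part M (\<lambda>A. Im (\<mu> A))) f \<and> integrable (neg_part M (\<lambda>A. Im (\<mu> A))) f"

definition cm_integral :: "'a measure \<Rightarrow> ('a set \<Rightarrow> complex) \<Rightarrow> ('a \<Rightarrow> complex) \<Rightarrow> complex" where
  "cm_integral M \<mu> f =
     (integral\<^sup>L (pos_part M (\<lambda>A. Re (\<mu> A))) f - integral\<^sup>L (neg_part M (\<lambda>A. Re (\<mu> A))) f) +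
     \<i> * (integral\<^sup>L (pos_part M (\<lambda>A. Im (\<mu> A))) f - integral\<^sup>L (neg_part M (\<lambda>A. Im (\<mu> A))) f)"

text \<open>
  \<open>measure_of\<close> yields the null measure when its argument is not countably additive. The following
  lemmas show that this does not happen here, and that integrating an indicator recovers \<open>\<mu>\<close>.
\<close>

lemma vector_measure_sums:
  "vector_measure M \<mu> \<Longrightarrow> range A \<subseteq> sets M \<Longrightarrow> disjoint_family A \<Longrightarrow>
    (\<lambda>i. \<mu> (A i)) sums \<mu> (\<Union>i. A i)" for A :: "nat \<Rightarrow> 'a set"
  by (simp add: vector_measure_def)

lemma disjoint_family_binaryset: "A \<inter> B = {} \<Longrightarrow> disjoint_family (binaryset A B)"
  by (auto simp: disjoint_family_on_def binaryset_def)

lemma vector_measure_Un: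
  assumes "vector_measure M \<mu>" "A \<in> sets M" "B \<in> sets M" "A \<inter> B = {}"
  shows "\<mu> (A \<union> B) = \<mu> A + \<mu> B"
proof -
  have e: "\<mu> {} = 0" using assms(1) by (simp add: vector_measure_def)
  have "range (binaryset A B) \<subseteq> sets M"
    using assms by (simp add: range_binaryset_eq)
  moreover have "disjoint_family (binaryset A B)"
    by (rule disjoint_family_binaryset[OF assms(4)])
  ultimately have "(\<lambda>i. \<mu> (binaryset A B i)) sums \<mu> (\<Union>i. binaryset A B i)"
    by (rule vector_measure_sums[OF assms(1)])
  moreover have "(\<lambda>i. \<mu> (binaryset A B i)) sums (\<mu> A + \<mu> B)"
    by (rule binaryset_sums[of \<mu>, OF e])
  ultimately show ?thesis
    unfolding UN_binaryset_eq by (rule sums_unique2)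
qed

lemma vector_measure_diff:
  assumes "vector_measure M \<mu>" "A \<in> sets M" "B \<in> sets M" "B \<subseteq> A"
  shows "\<mu> (A - B) = \<mu> A - \<mu> B"
proof -
  have "\<mu> (B \<union> (A - B)) = \<mu> B + \<mu> (A - B)"
    using assms by (intro vector_measure_Un) auto
  moreover have "B \<union> (A - B) = A" using assms by auto
  ultimately show ?thesis by simp
qed

lemma vector_measure_uminus:
  "vector_measure M \<mu> \<Longrightarrow> vector_measure M (\<lambda>A. - \<mu> A)"
  by (auto simp: vector_measure_def intro: sums_minus)

lemma vector_measure_Re: "complex_measure M \<mu> \<Longrightarrow> vector_measure M (\<lambda>A. Re (\<mu> A))"
  by (auto simp: vector_measure_def intro: sums_Re)

lemma vector_measure_Im: "complex_measure M \<mu> \<Longrightarrow> vector_measure M (\<lambda>A. Im (\<mu> A))"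
  by (auto simp: vector_measure_def intro: sums_Im)

lemma upper_variation_upper:
  "B \<in> sets M \<Longrightarrow> B \<subseteq> E \<Longrightarrow> ennreal (\<nu> B) \<le> upper_variation M \<nu> E"
  unfolding upper_variation_def by (rule SUP_upper) auto

lemma upper_variation_UN_le:
  assumes \<nu>: "vector_measure M \<nu>" and A: "range A \<subseteq> sets M" "disjoint_family A"
  shows "upper_variation M \<nu> (\<Union>i. A i) \<le> (\<Sum>i. upper_variation M \<nu> (A i))"
  unfolding upper_variation_def[of M \<nu> "\<Union>i. A i"]
proof (rule SUP_least, clarify)
  fix B assume B: "B \<in> sets M" "B \<subseteq> (\<Union>i. A i)"
  have "range (\<lambda>i. A i \<inter> B) \<subseteq> sets M" using A(1) B(1) by auto
  moreover have "disjoint_family (\<lambda>i. A i \<inter> B)"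
    by (rule disjoint_family_on_bisimulation[OF A(2)]) auto
  ultimately have "(\<lambda>i. \<nu> (A i \<inter> B)) sums \<nu> (\<Union>i. A i \<inter> B)"
    using vector_measure_sums[OF \<nu>] by blast
  moreover have "(\<Union>i. A i \<inter> B) = B" using B by auto
  ultimately have s: "(\<lambda>i. \<nu> (A i \<inter> B)) sums \<nu> B" by simp
  show "ennreal (\<nu> B) \<le> (\<Sum>i. upper_variation M \<nu> (A i))"
  proof (rule tendsto_le[OF sequentially_bot])
    show "(\<lambda>n. \<Sum>i<n. upper_variation M \<nu> (A i)) \<longlonglongrightarrow> (\<Sum>i. upper_variation M \<nu> (A i))"
      by (intro summable_LIMSEQ) simp
    show "(\<lambda>n. ennreal (\<Sum>i<n. \<nu> (A i \<inter> B))) \<longlonglongrightarrow> ennreal (\<nu> B)"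
      using s by (intro tendsto_ennrealI) (simp add: sums_def)
    have "ennreal (\<Sum>i<n. \<nu> (A i \<inter> B)) \<le> (\<Sum>i<n. upper_variation M \<nu> (A i))" for n
    proof -
      have "ennreal (\<Sum>i<n. \<nu> (A i \<inter> B)) \<le> ennreal (\<Sum>i<n. max 0 (\<nu> (A i \<inter> B)))"
        by (intro ennreal_leI sum_mono) auto
      also have "\<dots> = (\<Sum>i<n. ennreal (max 0 (\<nu> (A i \<inter> B))))"
        by (rule sum_ennreal[symmetric]) auto
      also have "\<dots> \<le> (\<Sum>i<n. upper_variation M \<nu> (A i))"
        using A(1) B(1)
        by (intro sum_mono) (auto simp: max_def ennreal_neg image_subset_iff
            intro!: upper_variation_upper)
      finally show ?thesis .
    qed
    then show "\<forall>\<^sub>F n in sequentially.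
        ennreal (\<Sum>i<n. \<nu> (A i \<inter> B)) \<le> (\<Sum>i<n. upper_variation M \<nu> (A i))"
      by simp
  qed
qed

lemma upper_variation_empty: "vector_measure M \<nu> \<Longrightarrow> upper_variation M \<nu> {} = 0"
proof -
  assume "vector_measure M \<nu>"
  moreover have "{B \<in> sets M. B \<subseteq> {}} = {{}}" by auto
  ultimately show ?thesis by (simp add: upper_variation_def vector_measure_def)
qed

lemma upper_variation_Un_le:
  assumes \<nu>: "vector_measure M \<nu>" and A: "A \<in> sets M" "B \<in> sets M" "A \<inter> B = {}"
  shows "upper_variation M \<nu> (A \<union> B) \<le> upper_variation M \<nu> A + upper_variation M \<nu> B"
proof -
  have "upper_variation M \<nu> (\<Union>i. binaryset A B i) \<le> (\<Sum>i. upper_variation M \<nu> (binaryset A B i))"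
    using A by (intro upper_variation_UN_le[OF \<nu>] disjoint_family_binaryset)
      (simp_all add: range_binaryset_eq)
  also have "\<dots> = upper_variation M \<nu> A + upper_variation M \<nu> B"
    by (rule suminf_binaryset_eq[of \<open>upper_variation M \<nu>\<close>, OF upper_variation_empty[OF \<nu>]])
  finally show ?thesis unfolding UN_binaryset_eq .
qed

lemma upper_variation_Un_ge:
  assumes \<nu>: "vector_measure M \<nu>" and A: "A \<inter> B = {}"
  shows "upper_variation M \<nu> A + upper_variation M \<nu> B \<le> upper_variation M \<nu> (A \<union> B)"
proof -
  have ne: "{C \<in> sets M. C \<subseteq> D} \<noteq> {}" for D by auto
  have pos: "ennreal (\<nu> C) + ennreal (\<nu> D) \<le> upper_variation M \<nu> (A \<union> B)"
    if C: "C \<in> sets M" "C \<subseteq> A" and D: "D \<in> sets M" "D \<subseteq> B" for C D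
  proof -
    have "\<nu> (C \<union> D) = \<nu> C + \<nu> D"
      using C D A by (intro vector_measure_Un[OF \<nu>]) auto
    moreover have "ennreal (\<nu> (C \<union> D)) \<le> upper_variation M \<nu> (A \<union> B)"
      using C D by (intro upper_variation_upper) auto
    moreover have "ennreal (\<nu> C) \<le> upper_variation M \<nu> (A \<union> B)"
      using C by (intro upper_variation_upper) auto
    moreover have "ennreal (\<nu> D) \<le> upper_variation M \<nu> (A \<union> B)"
      using D by (intro upper_variation_upper) auto
    ultimately show ?thesis
      by (cases "0 \<le> \<nu> C"; cases "0 \<le> \<nu> D") (auto simp: ennreal_neg)
  qed
  have "upper_variation M \<nu> A + upper_variation M \<nu> B =
      (SUP C\<in>{C \<in> sets M. C \<subseteq> A}. ennreal (\<nu> C) + upper_variation M \<nu> B)"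
    unfolding upper_variation_def[of M \<nu> A] by (rule ennreal_SUP_add_left[OF ne, symmetric])
  also have "\<dots> \<le> upper_variation M \<nu> (A \<union> B)"
  proof (rule SUP_least, clarify)
    fix C assume C: "C \<in> sets M" "C \<subseteq> A"
    have "ennreal (\<nu> C) + upper_variation M \<nu> B =
        (SUP D\<in>{D \<in> sets M. D \<subseteq> B}. ennreal (\<nu> C) + ennreal (\<nu> D))"
      unfolding upper_variation_def[of M \<nu> B] by (rule ennreal_SUP_add_right[OF ne])
    also have "\<dots> \<le> upper_variation M \<nu> (A \<union> B)"
      by (rule SUP_least) (use pos C in blast)
    finally show "ennreal (\<nu> C) + upper_variation M \<nu> B \<le> upper_variation M \<nu> (A \<union> B)" .
  qed
  finally show ?thesis .
qed

lemma upper_variation_mono: "A \<subseteq> B \<Longrightarrow> upper_variation M \<nu> A \<le> upper_variation M \<nu> B"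
  unfolding upper_variation_def by (intro SUP_subset_mono) auto

lemma countably_additive_upper_variation:
  assumes \<nu>: "vector_measure M \<nu>"
  shows "countably_additive (sets M) (upper_variation M \<nu>)"
  unfolding countably_additive_def
proof (intro allI impI)
  fix A :: "nat \<Rightarrow> 'a set"
  assume A: "range A \<subseteq> sets M" "disjoint_family A"
  have fin: "(\<Sum>i<n. upper_variation M \<nu> (A i)) \<le> upper_variation M \<nu> (\<Union>i<n. A i)" for n
  proof (induction n)
    case (Suc n)
    have "(\<Sum>i<Suc n. upper_variation M \<nu> (A i))
        \<le> upper_variation M \<nu> (\<Union>i<n. A i) + upper_variation M \<nu> (A n)"
      using Suc by (simp add: add_right_mono)
    also have "\<dots> \<le> upper_variation M \<nu> ((\<Union>i<n. A i) \<union> A n)"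
    proof (rule upper_variation_Un_ge[OF \<nu>])
      have "A i \<inter> A n = {}" if "i < n" for i
        using A(2) that by (simp add: disjoint_family_on_def)
      then show "(\<Union>i<n. A i) \<inter> A n = {}" by blast
    qed
    finally show ?case by (simp add: lessThan_Suc Un_commute)
  qed simp
  have "(\<Sum>i. upper_variation M \<nu> (A i)) \<le> upper_variation M \<nu> (\<Union>i. A i)"
    by (rule suminf_le_const) (auto intro: order.trans[OF fin] upper_variation_mono)
  with upper_variation_UN_le[OF \<nu> A]
  show "(\<Sum>i. upper_variation M \<nu> (A i)) = upper_variation M \<nu> (\<Union>i. A i)" by (rule order.antisym[rotated])
qed

lemma upper_variation_finite:
  assumes \<nu>: "vector_measure M \<nu>" and E: "E \<in> sets M"
  shows "upper_variation M \<nu> E < \<infinity>"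
proof (rule ccontr)
  assume "\<not> upper_variation M \<nu> E < \<infinity>"
  then have E0: "E \<in> {E \<in> sets M. upper_variation M \<nu> E = \<infinity>}" using E by (auto simp: less_top[symmetric])
  have step: "\<exists>F \<in> {F \<in> sets M. upper_variation M \<nu> F = \<infinity>}. F \<subseteq> E \<and> 1 < \<bar>\<nu> (E - F)\<bar>"
    if "E \<in> {E \<in> sets M. upper_variation M \<nu> E = \<infinity>}" for E
  proof -
    have E: "E \<in> sets M" "upper_variation M \<nu> E = \<infinity>" using that by auto
    have "ennreal (1 + \<bar>\<nu> E\<bar>) < upper_variation M \<nu> E" using E by simp
    then obtain B where B: "B \<in> sets M" "B \<subseteq> E" "ennreal (1 + \<bar>\<nu> E\<bar>) < ennreal (\<nu> B)"
      unfolding upper_variation_def less_SUP_iff by auto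
    then have b: "1 + \<bar>\<nu> E\<bar> < \<nu> B" by (subst (asm) ennreal_less_iff) simp_all
    have d: "\<nu> (E - B) = \<nu> E - \<nu> B" by (rule vector_measure_diff[OF \<nu> E(1) B(1,2)])
    have dd: "E - (E - B) = B" using B by auto
    have "upper_variation M \<nu> (B \<union> (E - B)) \<le> upper_variation M \<nu> B + upper_variation M \<nu> (E - B)"
      using E B by (intro upper_variation_Un_le[OF \<nu>]) auto
    moreover have "B \<union> (E - B) = E" using B by auto
    ultimately have "upper_variation M \<nu> B = \<infinity> \<or> upper_variation M \<nu> (E - B) = \<infinity>"
      using E(2) by (simp add: top_unique)
    then show ?thesis
    proof
      assume "upper_variation M \<nu> B = \<infinity>"
      then show ?thesis using B b d by (intro bexI[of _ B]) auto
    next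
      assume "upper_variation M \<nu> (E - B) = \<infinity>"
      then show ?thesis using B E b dd by (intro bexI[of _ "E - B"]) auto
    qed
  qed
  have "\<exists>F. \<forall>n. F n \<in> {E \<in> sets M. upper_variation M \<nu> E = \<infinity>} \<and>
      F (Suc n) \<subseteq> F n \<and> 1 < \<bar>\<nu> (F n - F (Suc n))\<bar>"
    using E0 step
    by (intro dependent_nat_choice[where P = "\<lambda>_ E. E \<in> {E \<in> sets M. upper_variation M \<nu> E = \<infinity>}"
        and Q = "\<lambda>_ E F. F \<subseteq> E \<and> 1 < \<bar>\<nu> (E - F)\<bar>"]) blast+
  then obtain F where F: "\<And>n. F n \<in> {E \<in> sets M. upper_variation M \<nu> E = \<infinity>}"
      "\<And>n. F (Suc n) \<subseteq> F n \<and> 1 < \<bar>\<nu> (F n - F (Suc n))\<bar>"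
    by blast
  have "decseq F" using F(2) by (intro decseq_SucI) auto
  from decseqD[OF this] have sub: "F n \<subseteq> F (Suc m)" if "m < n" for m n
    using that by simp
  have dis: "(F m - F (Suc m)) \<inter> (F n - F (Suc n)) = {}" if "m < n" for m n
    using sub[OF that] by blast
  have disj: "disjoint_family (\<lambda>n. F n - F (Suc n))"
    unfolding disjoint_family_on_def
  proof (intro ballI impI)
    fix m n :: nat
    assume "m \<noteq> n"
    then show "(F m - F (Suc m)) \<inter> (F n - F (Suc n)) = {}"
      using dis[of m n] dis[of n m] by (cases "m < n") (simp_all add: Int_commute)
  qed
  have "range (\<lambda>n. F n - F (Suc n)) \<subseteq> sets M" using F(1) by auto
  from vector_measure_sums[OF \<nu> this disj] have "summable (\<lambda>n. \<nu> (F n - F (Suc n)))"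
    by (rule sums_summable)
  then have "(\<lambda>n. \<nu> (F n - F (Suc n))) \<longlonglongrightarrow> 0" by (rule summable_LIMSEQ_zero)
  from LIMSEQ_D[OF this, of 1] obtain n where "norm (\<nu> (F n - F (Suc n)) - 0) < 1"
    by auto
  with F(2)[of n] show False by simp
qed

lemma space_pos_part [simp]: "space (pos_part M \<nu>) = space M"
  and sets_pos_part [simp, measurable_cong]: "sets (pos_part M \<nu>) = sets M"
  and space_neg_part [simp]: "space (neg_part M \<nu>) = space M"
  and sets_neg_part [simp, measurable_cong]: "sets (neg_part M \<nu>) = sets M"
  by (simp_all add: pos_part_def neg_part_def)

lemma emeasure_pos_part:
  assumes "vector_measure M \<nu>" "E \<in> sets M"
  shows "emeasure (pos_part M \<nu>) E = upper_variation M \<nu> E"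
proof (rule emeasure_measure_of[OF pos_part_def sets.space_closed])
  show "E \<in> sets (pos_part M \<nu>)" using assms by simp
  show "positive (sets (pos_part M \<nu>)) (upper_variation M \<nu>)"
    using upper_variation_empty[OF assms(1)] by (simp add: positive_def)
  show "countably_additive (sets (pos_part M \<nu>)) (upper_variation M \<nu>)"
    using countably_additive_upper_variation[OF assms(1)] by simp
qed

lemma jordan_decomposition:
  assumes \<nu>: "vector_measure M \<nu>" and E: "E \<in> sets M"
  shows "\<nu> E = measure (pos_part M \<nu>) E - measure (neg_part M \<nu>) E"
proof -
  define p where "p = measure (pos_part M \<nu>) E"
  define n where "n = measure (neg_part M \<nu>) E"
  note \<nu>' = vector_measure_uminus[OF \<nu>]
  have p: "upper_variation M \<nu> E = ennreal p"
    using emeasure_pos_part[OF \<nu> E] upper_variation_finite[OF \<nu> E]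
    by (simp add: p_def measure_def less_top)
  have n: "upper_variation M (\<lambda>A. - \<nu> A) E = ennreal n"
    using emeasure_pos_part[OF \<nu>' E] upper_variation_finite[OF \<nu>' E]
    by (simp add: n_def neg_part_def measure_def less_top)
  have nn: "p \<ge> 0" "n \<ge> 0" by (simp_all add: p_def n_def)
  have ub: "\<nu> B \<le> p" "- \<nu> B \<le> n" if "B \<in> sets M" "B \<subseteq> E" for B
    using upper_variation_upper[OF that, of \<nu>] upper_variation_upper[OF that, of "\<lambda>A. - \<nu> A"] nn
    unfolding p n by (auto simp: ennreal_le_iff)
  have bound: "q \<le> r"
    if q: "upper_variation M f E = ennreal q" and r: "r \<ge> 0"
      and f: "\<And>B. B \<in> sets M \<Longrightarrow> B \<subseteq> E \<Longrightarrow> f B \<le> r" for q r f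
  proof -
    have "ennreal q \<le> ennreal r"
      unfolding q[symmetric] upper_variation_def using f by (intro SUP_least ennreal_leI) auto
    then show ?thesis using r by (simp add: ennreal_le_iff)
  qed
  have dif: "\<nu> B = \<nu> E - \<nu> (E - B)" if "B \<in> sets M" "B \<subseteq> E" for B
    using vector_measure_diff[OF \<nu> E that] by simp
  have e: "\<nu> {} = 0" using \<nu> by (simp add: vector_measure_def)
  have "p \<le> \<nu> E + n"
  proof (rule bound[OF p])
    show "0 \<le> \<nu> E + n" using ub(2)[OF E] by simp
    show "\<nu> B \<le> \<nu> E + n" if "B \<in> sets M" "B \<subseteq> E" for B
      using dif[OF that] ub(2)[of "E - B"] that E by auto
  qed
  moreover have "n \<le> p - \<nu> E"
  proof (rule bound[OF n])
    show "0 \<le> p - \<nu> E" using ub(1)[OF E] by simp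
    show "- \<nu> B \<le> p - \<nu> E" if "B \<in> sets M" "B \<subseteq> E" for B
      using dif[OF that] ub(1)[of "E - B"] that E by auto
  qed
  ultimately show ?thesis by (simp add: p_def n_def)
qed

lemma cm_integral_indicator:
  assumes "complex_measure M \<mu>" "E \<in> sets M"
  shows "cm_integral M \<mu> (indicator E) = \<mu> E"
proof -
  have sp: "E \<inter> space M = E" using assms(2) sets.sets_into_space by blast
  have int: "integral\<^sup>L N (indicator E :: _ \<Rightarrow> complex) = of_real (measure N E)"
    if "space N = space M" for N :: "'a measure"
  proof -
    have "integral\<^sup>L N (indicator E :: _ \<Rightarrow> complex) =
        integral\<^sup>L N (\<lambda>x. complex_of_real (indicator E x))"
      by (rule Bochner_Integration.integral_cong) (auto simp: indicator_def)
    also have "\<dots> = of_real (integral\<^sup>L N (indicator E))" by (rule integral_complex_of_real)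
    finally show ?thesis using that sp by simp
  qed
  show ?thesis
    unfolding cm_integral_def
    using jordan_decomposition[OF vector_measure_Re[OF assms(1)] assms(2)]
      jordan_decomposition[OF vector_measure_Im[OF assms(1)] assms(2)]
    by (simp add: int complex_eq_iff)
qed


section \<open>Quasiorthogonal polynomials and quadrature\<close>

definition quasiorthogonal :: "real \<Rightarrow> nat \<Rightarrow> (real set \<Rightarrow> complex) \<Rightarrow> complex poly \<Rightarrow> bool" where
  "quasiorthogonal \<epsilon> N \<alpha> p \<longleftrightarrow>
     (\<forall>n\<le>N. cmod (cm_integral borel \<alpha> (\<lambda>t. poly p (of_real t) * of_real t ^ n)) \<le> \<epsilon>)"

definition lagrange_basis :: "nat \<Rightarrow> (nat \<Rightarrow> complex) \<Rightarrow> nat \<Rightarrow> complex \<Rightarrow> complex" where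
  "lagrange_basis d x n t = (\<Prod>m\<in>{..d} - {n}. (t - x m) / (x n - x m))"

definition quadrature_weight ::
    "(real set \<Rightarrow> complex) \<Rightarrow> nat \<Rightarrow> (nat \<Rightarrow> complex) \<Rightarrow> nat \<Rightarrow> complex" where
  "quadrature_weight \<alpha> d x n = cm_integral borel \<alpha> (\<lambda>t. lagrange_basis d x n (of_real t))"

text \<open>Indices start from 0 here; the entries depend only on \<open>j - i\<close>.\<close>

definition toeplitz_mat :: "nat \<Rightarrow> nat \<Rightarrow> complex poly \<Rightarrow> complex mat" where
  "toeplitz_mat N d p =
     mat N N (\<lambda>(i, j). if i \<le> j \<and> j - i \<le> d + 1 then coeff p (d + 1 - (j - i)) else 0)"

definition upper_coeffs :: "nat \<Rightarrow> nat \<Rightarrow> complex poly \<Rightarrow> complex vec" where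
  "upper_coeffs N d q = vec N (\<lambda>i. coeff q (d + 1 + i))"

definition norm1_vec :: "complex vec \<Rightarrow> real" where
  "norm1_vec v = (\<Sum>i<dim_vec v. cmod (vec_index v i))"

text \<open>
  The inverse of a matrix that is known to be invertible; \<open>mat_inverse\<close> returns \<open>None\<close> otherwise.
\<close>

abbreviation mat_inv :: "complex mat \<Rightarrow> complex mat" where
  "mat_inv A \<equiv> the (mat_inverse A)"

lemma toeplitz_mat_inv:
  assumes "coeff p (d + 1) = 1"
  shows "toeplitz_mat N d p * mat_inv (toeplitz_mat N d p) = 1\<^sub>m N"
    and "mat_inv (toeplitz_mat N d p) * toeplitz_mat N d p = 1\<^sub>m N"
    and "mat_inv (toeplitz_mat N d p) \<in> carrier_mat N N"
proof -
  let ?G = "toeplitz_mat N d p"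
  have G: "?G \<in> carrier_mat N N" by (simp add: toeplitz_mat_def)
  have "upper_triangular ?G" by (auto simp: upper_triangular_def toeplitz_mat_def)
  then have "Determinant.det ?G = prod_list (diag_mat ?G)" using G by (rule det_upper_triangular)
  also have "\<dots> = 1"
    unfolding prod_list_diag_prod using assms by (intro prod.neutral) (auto simp: toeplitz_mat_def)
  finally have "?G \<in> Units (ring_mat TYPE(complex) N ())"
    using det_non_zero_imp_unit[OF G] by simp
  then obtain B where "mat_inverse ?G = Some B"
    using mat_inverse(1)[OF G, where b = "()"] by (cases "mat_inverse ?G") auto
  with mat_inverse(2)[OF G this]
  show "?G * mat_inv ?G = 1\<^sub>m N" "mat_inv ?G * ?G = 1\<^sub>m N" "mat_inv ?G \<in> carrier_mat N N"
    by auto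
qed

end

theory Submission
  imports Defs
begin

text \<open>
  Divide \<open>q\<close> by \<open>p\<close> with remainder, \<open>q = p f + r\<close>, where \<open>degree r \<le> d\<close> and \<open>degree f < N\<close>. The
  quadrature rule is exact on \<open>r\<close>, because it is obtained by integrating Lagrange interpolants
  (\<open>interpolatory_quadrature_exact\<close>), and it annihilates \<open>p f\<close>, because the nodes are zeros of
  \<open>p\<close>. Hence the error is exactly the integral of \<open>p f\<close>, that is, a combination of the integrals of
  \<open>p x\<^sup>j\<close> with coefficients \<open>f\<^sub>j\<close>. Each of these is at most \<open>\<epsilon>\<close> in modulus by quasiorthogonality,
  so the error is at most the \<open>1\<close>-norm of the coefficient vector of \<open>f\<close> times \<open>\<epsilon>\<close>.

  It remains to identify that vector. In degrees \<open>d + 1, \<dots>, N + d\<close> the remainder does not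
  contribute, and comparing coefficients in \<open>q = p f + r\<close> there says precisely that the Toeplitz
  matrix of \<open>p\<close> maps the coefficient vector of \<open>f\<close> to the vector of upper coefficients of \<open>q\<close>
  (\<open>toeplitz_mat_mult_quotient_coeffs\<close>). As the matrix is unitriangular, this determines \<open>f\<close>.
\<close>

section \<open>Integration of polynomials against a complex measure\<close>

lemma cm_integrable_lincomb:
  assumes "\<And>i. i \<in> A \<Longrightarrow> cm_integrable M \<mu> (f i)"
  shows "cm_integrable M \<mu> (\<lambda>t. \<Sum>i\<in>A. c i * f i t)"
  using assms unfolding cm_integrable_def
  by (intro conjI Bochner_Integration.integrable_sum integrable_mult_right) auto

lemma cm_integral_lincomb:
  assumes "\<And>i. i \<in> A \<Longrightarrow> cm_integrable M \<mu> (f i)"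
  shows "cm_integral M \<mu> (\<lambda>t. \<Sum>i\<in>A. c i * f i t) = (\<Sum>i\<in>A. c i * cm_integral M \<mu> (f i))"
proof -
  have part: "integral\<^sup>L N (\<lambda>t. \<Sum>i\<in>A. c i * f i t) = (\<Sum>i\<in>A. c i * integral\<^sup>L N (f i))"
    if "\<And>i. i \<in> A \<Longrightarrow> integrable N (f i)" for N
    using that by (subst Bochner_Integration.integral_sum) auto
  show ?thesis
    using assms unfolding cm_integral_def cm_integrable_def
    by (subst (1 2 3 4) part)
      (simp_all add: sum_subtractf sum.distrib sum_distrib_left algebra_simps)
qed

lemma cm_integral_add:
  assumes "cm_integrable M \<mu> f" "cm_integrable M \<mu> g"
  shows "cm_integral M \<mu> (\<lambda>t. f t + g t) = cm_integral M \<mu> f + cm_integral M \<mu> g"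
  using assms unfolding cm_integral_def cm_integrable_def
  by (simp add: algebra_simps)

lemma cm_integrable_poly:
  fixes r :: "complex poly"
  assumes "\<forall>n\<le>K. cm_integrable borel \<alpha> (\<lambda>t. of_real t ^ n)" "degree r \<le> K"
  shows "cm_integrable borel \<alpha> (\<lambda>t. poly r (of_real t))"
  unfolding poly_altdef using assms by (intro cm_integrable_lincomb) auto

section \<open>Exactness of interpolatory quadrature\<close>

definition lagrange_poly :: "nat \<Rightarrow> (nat \<Rightarrow> complex) \<Rightarrow> nat \<Rightarrow> complex poly" where
  "lagrange_poly d x n = (\<Prod>m\<in>{..d} - {n}. Polynomial.smult (1 / (x n - x m)) [:- x m, 1:])"

lemma poly_lagrange_poly: "poly (lagrange_poly d x n) t = lagrange_basis d x n t"
  unfolding lagrange_poly_def lagrange_basis_def poly_prod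
  by (intro prod.cong refl) (simp add: diff_divide_distrib)

lemma degree_lagrange_poly:
  assumes "n \<le> d"
  shows "degree (lagrange_poly d x n) \<le> d"
proof -
  have "degree (lagrange_poly d x n)
      \<le> (\<Sum>m\<in>{..d} - {n}. degree (Polynomial.smult (1 / (x n - x m)) [:- x m, 1:]))"
    unfolding lagrange_poly_def by (rule order.trans[OF degree_prod_sum_le]) (auto simp: o_def)
  also have "\<dots> \<le> (\<Sum>m\<in>{..d} - {n}. 1)"
    by (intro sum_mono) simp
  finally show ?thesis using assms by simp
qed

lemma lagrange_basis_node:
  assumes "inj_on x {..d}" "n \<le> d" "k \<le> d"
  shows "lagrange_basis d x n (x k) = (if k = n then 1 else 0)"
proof (cases "k = n")
  case True
  then show ?thesis
    using assms by (auto simp: lagrange_basis_def dest: inj_onD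
        split: if_splits intro!: prod.neutral)
next
  case False
  then show ?thesis using assms by (auto simp: lagrange_basis_def)
qed

text \<open>Both sides have degree at most \<open>d\<close> and agree at the \<open>d + 1\<close> nodes.\<close>

lemma lagrange_interpolation:
  assumes inj: "inj_on x {..d}" and r: "degree r \<le> d"
  shows "poly r t = (\<Sum>n\<le>d. poly r (x n) * lagrange_basis d x n t)"
proof -
  define s where "s = (\<Sum>n\<le>d. Polynomial.smult (poly r (x n)) (lagrange_poly d x n))"
  have "degree s \<le> d"
    unfolding s_def
    by (intro degree_sum_le order.trans[OF degree_smult_le] degree_lagrange_poly) auto
  moreover have "poly s (x k) = poly r (x k)" if "k \<le> d" for k
    using that
    by (simp add: s_def poly_sum poly_lagrange_poly lagrange_basis_node[OF inj] if_distrib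
        sum.delta cong: if_cong)
  ultimately have "r = s"
    using r by (intro poly_eqI_degree[of "x ` {..d}"]) (auto simp: card_image[OF inj])
  then have "poly r t = poly s t" by simp
  then show ?thesis by (simp add: s_def poly_sum poly_lagrange_poly)
qed

lemma interpolatory_quadrature_exact:
  assumes inj: "inj_on x {..d}" and r: "degree r \<le> d"
    and moments: "\<forall>n\<le>d. cm_integrable borel \<alpha> (\<lambda>t. of_real t ^ n)"
  shows "cm_integral borel \<alpha> (\<lambda>t. poly r (of_real t))
    = (\<Sum>n\<le>d. quadrature_weight \<alpha> d x n * poly r (x n))"
proof -
  have "cm_integrable borel \<alpha> (\<lambda>t. lagrange_basis d x n (of_real t))" if "n \<le> d" for n
    using cm_integrable_poly[OF moments degree_lagrange_poly[OF that]]
    by (simp add: poly_lagrange_poly)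
  then have "cm_integral borel \<alpha> (\<lambda>t. \<Sum>n\<le>d. poly r (x n) * lagrange_basis d x n (of_real t))
      = (\<Sum>n\<le>d. quadrature_weight \<alpha> d x n * poly r (x n))"
    by (subst cm_integral_lincomb) (auto simp: quadrature_weight_def mult.commute)
  then show ?thesis by (subst lagrange_interpolation[OF inj r])
qed

section \<open>Polynomial division as a Toeplitz system\<close>

text \<open>
  The row index \<open>i\<close> belongs to the monomial of degree \<open>d + 1 + i\<close>. In the convolution for that
  coefficient of \<open>p f\<close>, the factor \<open>f\<^sub>j\<close> meets \<open>p\<close> in degree \<open>d + 1 - (j - i)\<close>; the indices
  \<open>j < i\<close> drop out because \<open>p\<close> has no coefficients above degree \<open>d + 1\<close>.
\<close>

lemma toeplitz_mat_mult_quotient_coeffs: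
  fixes p f r :: "complex poly"
  assumes p: "degree p = d + 1" and r: "degree r \<le> d" and f: "\<And>j. N \<le> j \<Longrightarrow> coeff f j = 0"
  shows "toeplitz_mat N d p *\<^sub>v vec N (coeff f) = upper_coeffs N d (p * f + r)"
proof (rule eq_vecI)
  fix i assume "i < dim_vec (upper_coeffs N d (p * f + r))"
  then have i: "i < N" by (simp add: upper_coeffs_def)
  let ?a = "\<lambda>j. if i \<le> j \<and> j - i \<le> d + 1 then coeff p (d + 1 - (j - i)) else 0"
  have a: "coeff p (d + 1 + i - j) = ?a j" if "j \<le> d + 1 + i" for j
    using that p by (auto simp: coeff_eq_0 not_le)
  have "vec_index (toeplitz_mat N d p *\<^sub>v vec N (coeff f)) i = (\<Sum>j<N. ?a j * coeff f j)"
    using i by (simp add: toeplitz_mat_def scalar_prod_def lessThan_atLeast0)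
  \<comment> \<open>Both sums extend to the same range: \<open>f\<^sub>j\<close> vanishes from \<open>N\<close> on, \<open>?a j\<close> beyond \<open>d + 1 + i\<close>.\<close>
  also have "\<dots> = (\<Sum>j\<le>N + d + i + 1. ?a j * coeff f j)"
    using f by (intro sum.mono_neutral_left) auto
  also have "\<dots> = (\<Sum>j\<le>d + 1 + i. ?a j * coeff f j)"
    by (intro sum.mono_neutral_right) auto
  also have "\<dots> = (\<Sum>j\<le>d + 1 + i. coeff f j * coeff p (d + 1 + i - j))"
    by (intro sum.cong refl) (simp only: a atMost_iff mult.commute)
  also have "\<dots> = coeff (p * f) (d + 1 + i)"
    unfolding mult.commute[of p f] coeff_mult ..
  also have "\<dots> = vec_index (upper_coeffs N d (p * f + r)) i"
    using i r by (simp add: upper_coeffs_def coeff_eq_0)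
  finally show "vec_index (toeplitz_mat N d p *\<^sub>v vec N (coeff f)) i
      = vec_index (upper_coeffs N d (p * f + r)) i" .
qed (simp add: toeplitz_mat_def upper_coeffs_def)

section \<open>The quadrature error\<close>

lemma cm_integral_quasiorthogonal_mult_le:
  fixes p f :: "complex poly"
  assumes moments: "\<forall>n<N + degree p. cm_integrable borel \<alpha> (\<lambda>t. of_real t ^ n)"
    and quasi: "quasiorthogonal \<epsilon> N \<alpha> p"
    and f: "\<And>j. N \<le> j \<Longrightarrow> coeff f j = 0"
  shows "cmod (cm_integral borel \<alpha> (\<lambda>t. poly (p * f) (of_real t)))
    \<le> norm1_vec (vec N (coeff f)) * \<epsilon>"
proof -
  let ?g = "\<lambda>j t. poly p (of_real t) * of_real t ^ j :: complex"
  have g: "cm_integrable borel \<alpha> (?g j)" if "j < N" for j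
  proof -
    have "degree (p * monom 1 j) \<le> degree p + j"
      by (rule order.trans[OF degree_mult_le]) (simp add: degree_monom_eq)
    moreover have "\<forall>n\<le>degree p + j. cm_integrable borel \<alpha> (\<lambda>t. of_real t ^ n)"
      using moments that by auto
    ultimately have "cm_integrable borel \<alpha> (\<lambda>t. poly (p * monom 1 j) (of_real t))"
      by (intro cm_integrable_poly)
    then show ?thesis by (simp add: poly_monom)
  qed
  have "poly f z = (\<Sum>j<N. coeff f j * z ^ j)" for z
    unfolding poly_altdef using f
    by (intro sum.mono_neutral_cong) (auto simp: coeff_eq_0 not_le not_less)
  then have "(\<lambda>t. poly (p * f) (of_real t)) = (\<lambda>t. \<Sum>j<N. coeff f j * ?g j t)"
    by (simp add: sum_distrib_left mult_ac)
  then have "cm_integral borel \<alpha> (\<lambda>t. poly (p * f) (of_real t))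
      = (\<Sum>j<N. coeff f j * cm_integral borel \<alpha> (?g j))"
    using g by (simp only:) (intro cm_integral_lincomb, simp)
  also have "cmod \<dots> \<le> (\<Sum>j<N. cmod (coeff f j) * \<epsilon>)"
    using quasi unfolding quasiorthogonal_def
    by (intro sum_norm_le) (simp add: norm_mult mult_left_mono)
  finally show ?thesis by (simp add: norm1_vec_def sum_distrib_right)
qed

theorem theorem3:
  fixes \<alpha> :: "real set \<Rightarrow> complex" and N d :: nat and \<epsilon> :: real
    and p :: "complex poly" and x :: "nat \<Rightarrow> complex"
  assumes "complex_measure borel \<alpha>"
    and "N \<ge> 1"
    and "\<forall>n\<le>N + d + 1. cm_integrable borel \<alpha> (\<lambda>t. of_real t ^ n)"
    and "0 < \<epsilon>" and "\<epsilon> < 1"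
    and "degree p = d + 1" and "lead_coeff p = 1"
    and "quasiorthogonal \<epsilon> N \<alpha> p"
    and "inj_on x {..d}" and "{z. poly p z = 0} = x ` {..d}"
  shows "\<forall>q :: complex poly. degree q \<le> N + d \<longrightarrow>
    cmod (cm_integral borel \<alpha> (\<lambda>t. poly q (of_real t))
          - (\<Sum>n\<le>d. quadrature_weight \<alpha> d x n * poly q (x n)))
      \<le> norm1_vec (mat_inv (toeplitz_mat N d p) *\<^sub>v upper_coeffs N d q) * \<epsilon>"
proof (intro allI impI)
  fix q :: "complex poly"
  assume q: "degree q \<le> N + d"
  note moments = assms(3) and deg_p = assms(6)
  define f where "f = q div p"
  define r where "r = q mod p"
  have qfr: "q = p * f + r" by (simp add: f_def r_def)
  have "p \<noteq> 0" using deg_p by auto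
  then have r: "degree r \<le> d"
    using degree_mod_less'[of p q] deg_p unfolding r_def by (cases "q mod p = 0") auto
  have f: "coeff f j = 0" if "N \<le> j" for j
  proof (cases "f = 0")
    case False
    then have "degree (p * f) = d + 1 + degree f"
      using \<open>p \<noteq> 0\<close> deg_p by (simp add: degree_mult_eq)
    moreover have "degree (p * f) \<le> N + d"
      using degree_diff_le[of q "N + d" r] q r qfr by simp
    ultimately show ?thesis using that by (intro coeff_eq_0) simp
  qed simp

  let ?G = "toeplitz_mat N d p"
  have G: "?G \<in> carrier_mat N N" by (simp add: toeplitz_mat_def)
  have "coeff p (d + 1) = 1" using assms(6,7) by simp
  note inv = toeplitz_mat_inv[OF this, of N]
  have "mat_inv ?G *\<^sub>v upper_coeffs N d q = mat_inv ?G *\<^sub>v (?G *\<^sub>v vec N (coeff f))"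
    using toeplitz_mat_mult_quotient_coeffs[OF deg_p r f] qfr by simp
  also have "\<dots> = (mat_inv ?G * ?G) *\<^sub>v vec N (coeff f)"
    by (rule assoc_mult_mat_vec[symmetric, OF inv(3) G vec_carrier])
  finally have quotient: "mat_inv ?G *\<^sub>v upper_coeffs N d q = vec N (coeff f)"
    using inv(2) by simp

  have "poly q (x n) = poly r (x n)" if "n \<le> d" for n
  proof -
    have "poly p (x n) = 0" using assms(10) that by auto
    then show ?thesis by (simp add: qfr)
  qed
  then have "(\<Sum>n\<le>d. quadrature_weight \<alpha> d x n * poly q (x n))
      = cm_integral borel \<alpha> (\<lambda>t. poly r (of_real t))"
    using interpolatory_quadrature_exact[OF assms(9) r, of \<alpha>] moments by simp
  moreover have "cm_integral borel \<alpha> (\<lambda>t. poly q (of_real t))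
      = cm_integral borel \<alpha> (\<lambda>t. poly (p * f) (of_real t))
        + cm_integral borel \<alpha> (\<lambda>t. poly r (of_real t))"
  proof -
    have "degree (p * f) \<le> N + d + 1"
      using degree_diff_le[of q "N + d" r] q r qfr by simp
    moreover have "degree r \<le> N + d + 1" using r by simp
    ultimately show ?thesis
      unfolding qfr poly_add by (intro cm_integral_add cm_integrable_poly[OF moments])
  qed
  ultimately show "cmod (cm_integral borel \<alpha> (\<lambda>t. poly q (of_real t))
          - (\<Sum>n\<le>d. quadrature_weight \<alpha> d x n * poly q (x n)))
      \<le> norm1_vec (mat_inv ?G *\<^sub>v upper_coeffs N d q) * \<epsilon>"
    unfolding quotient
    using cm_integral_quasiorthogonal_mult_le[OF _ assms(8) f] moments deg_p by simp
qed

end
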